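(* Let $\mathbf{u}$ be an infinite word over a ternary alphabet $\mathcal{A}$ whose language $\mathcal{L}(\mathbf{u})$ is closed under reversal. If the complexity of $\mathbf{u}$ satisfies $\mathcal{C}(n)=2n+1$ for every $n\in\mathbb{N}$, then $\mathbf{u}$ has the property $\mathcal{P}$, i.e. $\mathcal{P}(n)+\mathcal{P}(n+1)=1+\#\mathcal{A}=4$ for every $n\in\mathbb{N}$.
   Context: $\mathbb{N}$ includes $0$. The language $\mathcal{L}(\mathbf{u})$ of an infinite word $\mathbf{u}=u_0u_1u_2\ldots$ is the set of all its finite factors (contiguous subwords), including the empty word; $\mathcal{L}_n(\mathbf{u})$ is the set of factors of length $n$. The complexity is $\mathcal{C}(n)=\#\mathcal{L}_n(\mathbf{u})$. The reversal of $w=w_0\cdots w_{n-1}$ is $\overline{w}=w_{n-1}\cdots w_0$; a palindrome is a word with $w=\overline{w}$. $\mathcal{L}(\mathbf{u})$ is closed under reversal if $w\in\mathcal{L}(\mathbf{u})$ implies $\overline{w}\in\mathcal{L}(\mathbf{u})$. $\mathcal{P}(n)$ denotes the number of palindromic factors of length $n$ in $\mathcal{L}(\mathbf{u})$. *)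

theory Defs
  imports Complex_Main "HOL-Library.Omega_Words_Fun"
begin

text \<open>
  Infinite words are functions on \<open>nat\<close>, finite words are lists, and \<open>u [i \<rightarrow> j]\<close> is the
  finite word \<open>u i, \<dots>, u (j - 1)\<close>. The case \<open>i = j\<close> yields the empty factor.
\<close>

definition language :: "'a word \<Rightarrow> 'a list set" where
  "language u = {u [i \<rightarrow> j] | i j. i \<le> j}"

definition factors :: "'a word \<Rightarrow> nat \<Rightarrow> 'a list set" where
  "factors u n = {w \<in> language u. length w = n}"

definition complexity :: "'a word \<Rightarrow> nat \<Rightarrow> nat" where
  "complexity u n = card (factors u n)"

definition palindrome :: "'a list \<Rightarrow> bool" where
  "palindrome w \<longleftrightarrow> w = rev w"

definition closed_under_reversal :: "'a list set \<Rightarrow> bool" where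
  "closed_under_reversal L \<longleftrightarrow> (\<forall>w \<in> L. rev w \<in> L)"

definition palindromic_complexity :: "'a word \<Rightarrow> nat \<Rightarrow> nat" where
  "palindromic_complexity u n = card {w \<in> factors u n. palindrome w}"

text \<open>The alphabet is an explicit parameter, since \<open>u\<close> need not a priori use all its letters.\<close>

definition property_P :: "'a set \<Rightarrow> 'a word \<Rightarrow> bool" where
  "property_P A u \<longleftrightarrow>
     (\<forall>n. palindromic_complexity u n + palindromic_complexity u (n + 1) = 1 + card A)"

end

theory Submission
  imports Defs
begin

text \<open>
  Let \<open>T n\<close> be the number of palindromic factors of length \<open>n\<close> or \<open>n + 1\<close>; then \<open>T 0 = 4\<close>.
  Counting vertices and edges of the Rauzy graph modulo reversal gives \<open>T n \<le> 4\<close>. Counting the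
  two-sided extensions of palindromes shows that there are at least as many palindromic factors of
  length \<open>n + 2\<close> as of length \<open>n\<close>, so \<open>T\<close> is nondecreasing and therefore constantly \<open>4\<close>.
\<close>

section \<open>Orbits of an involution\<close>

text \<open>Give fixed points weight 2 and all other points weight 1: every orbit then has total
  weight 2. It is applied to the reversal of words and to the swap of pairs of letters.\<close>

lemma card_involution_orbits:
  assumes fin: "finite X"
    and closed: "\<And>x. x \<in> X \<Longrightarrow> r x \<in> X" and invol: "\<And>x. r (r x) = x"
  shows "2 * card ((\<lambda>x. {x, r x}) ` X) = card X + card {x \<in> X. r x = x}"
proof -
  let ?h = "\<lambda>x. 1 + (if r x = x then 1 else 0 :: nat)"
  have fiber: "{x. x \<in> X \<and> {x, r x} = {a, r a}} = {a, r a}" if "a \<in> X" for a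
    using closed[OF that] that invol by (auto simp: doubleton_eq_iff)
  have "card X + card {x \<in> X. r x = x} = sum ?h X"
    using fin by (simp only: sum.distrib) (simp add: sum.If_cases Int_def)
  also have "\<dots> = (\<Sum>c\<in>(\<lambda>x. {x, r x}) ` X. sum ?h {x. x \<in> X \<and> {x, r x} = c})"
    by (rule sum.image_gen[OF fin])
  also have "\<dots> = (\<Sum>c\<in>(\<lambda>x. {x, r x}) ` X. 2)"
  proof (rule sum.cong[OF refl])
    fix c assume "c \<in> (\<lambda>x. {x, r x}) ` X"
    then obtain a where a: "a \<in> X" "c = {a, r a}" by auto
    show "sum ?h {x. x \<in> X \<and> {x, r x} = c} = 2"
      unfolding a(2) fiber[OF a(1)] using invol[of a] by (cases "r a = a") auto
  qed
  finally show ?thesis by simp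
qed

section \<open>Factors of an infinite word and their extensions\<close>

lemma factors_eq_range: "factors u n = range (\<lambda>i. (u [i \<rightarrow> i + n]))"
proof -
  have "(\<exists>i j. w = (u [i \<rightarrow> j]) \<and> i \<le> j) \<and> length w = n \<longleftrightarrow> (\<exists>i. w = (u [i \<rightarrow> i + n]))" for w
    by (auto simp: le_iff_add)
  then show ?thesis by (auto simp: factors_def language_def)
qed

lemma subsequence_Suc_right: "(u [i \<rightarrow> Suc (i + n)]) = (u [i \<rightarrow> i + n]) @ [u (i + n)]"
  by (simp add: subsequence_def)

lemma subsequence_Suc_left: "(u [i \<rightarrow> Suc (i + n)]) = u i # (u [Suc i \<rightarrow> Suc i + n])"
  by (simp add: subsequence_def upt_conv_Cons del: upt_Suc)

definition right_ext :: "'a word \<Rightarrow> 'a list \<Rightarrow> 'a set" where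
  "right_ext u w = {x. w @ [x] \<in> factors u (Suc (length w))}"

definition left_ext :: "'a word \<Rightarrow> 'a list \<Rightarrow> 'a set" where
  "left_ext u w = {x. x # w \<in> factors u (Suc (length w))}"

definition both_ext :: "'a word \<Rightarrow> 'a list \<Rightarrow> ('a \<times> 'a) set" where
  "both_ext u w = {(x, y). x # w @ [y] \<in> factors u (Suc (Suc (length w)))}"

definition pal_ext :: "'a word \<Rightarrow> 'a list \<Rightarrow> 'a set" where
  "pal_ext u w = {x. (x, x) \<in> both_ext u w}"

text \<open>Also known as bilateral multiplicity. It is an integer because negative values
  occur.\<close>

definition bilateral_order :: "'a word \<Rightarrow> 'a list \<Rightarrow> int" where
  "bilateral_order u w =
     int (card (both_ext u w)) - int (card (left_ext u w)) - int (card (right_ext u w)) + 1"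

lemma length_factor: "w \<in> factors u n \<Longrightarrow> length w = n"
  by (simp add: factors_def)

lemma factor_prefix: "w @ [x] \<in> factors u (Suc n) \<Longrightarrow> w \<in> factors u n"
  by (auto simp: factors_eq_range subsequence_Suc_right)

lemma factor_suffix: "x # w \<in> factors u (Suc n) \<Longrightarrow> w \<in> factors u n"
proof -
  assume "x # w \<in> factors u (Suc n)"
  then obtain i where "x # w = (u [i \<rightarrow> Suc (i + n)])" by (auto simp: factors_eq_range)
  then have "w = (u [Suc i \<rightarrow> Suc i + n])" by (simp only: subsequence_Suc_left list.inject)
  then show ?thesis by (auto simp only: factors_eq_range)
qed

lemma right_ext_nonempty: "w \<in> factors u n \<Longrightarrow> right_ext u w \<noteq> {}"
proof -
  assume "w \<in> factors u n"
  then obtain i where i: "w = (u [i \<rightarrow> i + n])" by (auto simp: factors_eq_range)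
  then have "w @ [u (i + n)] = (u [i \<rightarrow> i + Suc n])" by (simp add: subsequence_Suc_right)
  then show ?thesis using i by (auto simp: right_ext_def factors_eq_range)
qed

section \<open>Extension counts under closure by reversal\<close>

locale reversal_closed_word =
  fixes u :: "'a word"
  assumes reversal: "closed_under_reversal (language u)"
    and finite_factors: "finite (factors u n)"
begin

lemma rev_factor_iff [simp]: "rev w \<in> factors u n \<longleftrightarrow> w \<in> factors u n"
proof -
  have "rev v \<in> language u" if "v \<in> language u" for v
    using reversal that by (simp add: closed_under_reversal_def)
  from this[of w] this[of "rev w"] show ?thesis by (auto simp: factors_def)
qed

lemma left_ext_eq: "left_ext u w = right_ext u (rev w)"
proof -
  have "x # w \<in> factors u k \<longleftrightarrow> rev w @ [x] \<in> factors u k" for x k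
    using rev_factor_iff[of "x # w" k] by simp
  then show ?thesis by (simp add: left_ext_def right_ext_def)
qed

text \<open>A factor of a one-sided word might occur only at position 0. A right extension of its
  reversal, read backwards, is the left extension sought.\<close>

lemma left_ext_nonempty: "w \<in> factors u n \<Longrightarrow> left_ext u w \<noteq> {}"
  by (simp add: left_ext_eq right_ext_nonempty)

lemma both_ext_subset: "both_ext u w \<subseteq> left_ext u w \<times> right_ext u w"
  using factor_prefix[of "_ # w"] factor_suffix[of _ "w @ [_]"]
  by (auto simp: both_ext_def left_ext_def right_ext_def)

lemma both_ext_left:
  assumes "x \<in> left_ext u w" shows "\<exists>y. (x, y) \<in> both_ext u w"
  using right_ext_nonempty[of "x # w"] assms
  by (auto simp: left_ext_def both_ext_def right_ext_def)

lemma both_ext_right: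
  assumes "y \<in> right_ext u w" shows "\<exists>x. (x, y) \<in> both_ext u w"
  using left_ext_nonempty[of "w @ [y]"] assms
  by (auto simp: left_ext_def both_ext_def right_ext_def)

lemma factors_Suc_right:
  "bij_betw (\<lambda>(w, x). w @ [x]) (SIGMA w:factors u n. right_ext u w) (factors u (Suc n))"
proof (rule bij_betw_imageI)
  show "inj_on (\<lambda>(w, x). w @ [x]) (SIGMA w:factors u n. right_ext u w)"
    by (auto simp: inj_on_def)
  show "(\<lambda>(w, x). w @ [x]) ` (SIGMA w:factors u n. right_ext u w) = factors u (Suc n)"
  proof (intro equalityI subsetI)
    fix v assume v: "v \<in> factors u (Suc n)"
    then obtain w x where "v = w @ [x]" by (metis length_factor length_Suc_conv_rev)
    with v show "v \<in> (\<lambda>(w, x). w @ [x]) ` (SIGMA w:factors u n. right_ext u w)"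
      using factor_prefix[of w x u n] length_factor[of w u n]
      by (auto simp: right_ext_def intro!: image_eqI[of _ _ "(w, x)"])
  qed (auto simp: right_ext_def length_factor)
qed

lemma factors_Suc_Suc:
  "bij_betw (\<lambda>(w, x, y). x # w @ [y]) (SIGMA w:factors u n. both_ext u w) (factors u (Suc (Suc n)))"
proof (rule bij_betw_imageI)
  show "inj_on (\<lambda>(w, x, y). x # w @ [y]) (SIGMA w:factors u n. both_ext u w)"
    by (auto simp: inj_on_def)
  show "(\<lambda>(w, x, y). x # w @ [y]) ` (SIGMA w:factors u n. both_ext u w) = factors u (Suc (Suc n))"
  proof (intro equalityI subsetI)
    fix v assume v: "v \<in> factors u (Suc (Suc n))"
    then obtain w x y where vw: "v = x # w @ [y]"
      by (metis length_factor length_Suc_conv_rev length_Suc_conv)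
    with v have "w \<in> factors u n"
      using factor_prefix factor_suffix by metis
    with v vw show "v \<in> (\<lambda>(w, x, y). x # w @ [y]) ` (SIGMA w:factors u n. both_ext u w)"
      using length_factor[of w u n]
      by (auto simp: both_ext_def intro!: image_eqI[of _ _ "(w, x, y)"])
  qed (auto simp: both_ext_def length_factor)
qed

lemma finite_right_ext [simp]: "finite (right_ext u w)"
proof -
  have "(\<lambda>x. w @ [x]) ` right_ext u w \<subseteq> factors u (Suc (length w))"
    by (auto simp: right_ext_def)
  then have "finite ((\<lambda>x. w @ [x]) ` right_ext u w)"
    using finite_factors finite_subset by blast
  then show ?thesis by (rule finite_imageD) (auto simp: inj_on_def)
qed

lemma finite_left_ext [simp]: "finite (left_ext u w)"
  by (simp add: left_ext_eq)

lemma finite_both_ext [simp]: "finite (both_ext u w)"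
  by (rule finite_subset[OF both_ext_subset]) simp

lemma finite_pal_ext [simp]: "finite (pal_ext u w)"
  using finite_subset[of "pal_ext u w" "left_ext u w"] both_ext_subset[of w]
  by (auto simp: pal_ext_def)

lemma complexity_Suc: "complexity u (Suc n) = (\<Sum>w\<in>factors u n. card (right_ext u w))"
  using bij_betw_same_card[OF factors_Suc_right[of n]] finite_factors
  by (simp add: complexity_def)

text \<open>Reversal permutes the factors of length \<open>n\<close> and exchanges left and right
  extensions.\<close>

lemma sum_left_ext:
  "(\<Sum>w\<in>factors u n. g (card (left_ext u w))) = (\<Sum>w\<in>factors u n. g (card (right_ext u w)))"
  by (rule sum.reindex_bij_witness[of _ rev rev]) (auto simp: left_ext_eq)

lemma complexity_Suc_Suc: "complexity u (Suc (Suc n)) = (\<Sum>w\<in>factors u n. card (both_ext u w))"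
  using bij_betw_same_card[OF factors_Suc_Suc[of n]] finite_factors
  by (simp add: complexity_def)

text \<open>The two-sided counts add up to the complexity at \<open>n + 2\<close>, each one-sided
  count to that at \<open>n + 1\<close>, and the constant 1 to that at \<open>n\<close>. This second
  difference vanishes when the complexity is affine.\<close>

lemma sum_bilateral_order:
  "(\<Sum>w\<in>factors u n. bilateral_order u w) =
     int (complexity u (Suc (Suc n))) - 2 * int (complexity u (Suc n)) + int (complexity u n)"
  using sum_left_ext[of int n]
  by (simp add: bilateral_order_def sum.distrib sum_subtractf complexity_Suc_Suc[of n] complexity_Suc[of n])
     (simp add: complexity_def)

text \<open>Stripping the outer letters of a palindrome leaves a palindrome, and the two letters
  removed are equal.\<close>

lemma palindromic_complexity_Suc_Suc:
  "palindromic_complexity u (Suc (Suc n)) =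
     (\<Sum>w | w \<in> factors u n \<and> palindrome w. card (pal_ext u w))"
proof -
  let ?S = "SIGMA w:{w \<in> factors u n. palindrome w}. pal_ext u w"
  have "bij_betw (\<lambda>(w, x). x # w @ [x]) ?S {v \<in> factors u (Suc (Suc n)). palindrome v}"
  proof (rule bij_betw_imageI)
    show "inj_on (\<lambda>(w, x). x # w @ [x]) ?S"
      by (auto simp: inj_on_def)
    show "(\<lambda>(w, x). x # w @ [x]) ` ?S = {v \<in> factors u (Suc (Suc n)). palindrome v}"
    proof (intro equalityI subsetI)
      fix v assume v: "v \<in> {v \<in> factors u (Suc (Suc n)). palindrome v}"
      then obtain w x y where vw: "v = x # w @ [y]"
        by (metis (no_types, lifting) mem_Collect_eq length_factor length_Suc_conv_rev length_Suc_conv)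
      with v have "w \<in> factors u n"
        using factor_prefix[of "x # w" y u "Suc n"] factor_suffix[of x w u n] by simp
      moreover from v have "x # w @ [y] = rev (x # w @ [y])"
        unfolding vw palindrome_def by blast
      then have "x = y" "w = rev w"
        unfolding rev.simps rev_append append.simps list.inject append1_eq_conv by blast+
      then have "y = x" "palindrome w" unfolding palindrome_def by blast+
      ultimately have "w \<in> factors u n" "y = x" "palindrome w" by blast+
      with v vw show "v \<in> (\<lambda>(w, x). x # w @ [x]) ` ?S"
        using length_factor[of w u n]
        by (auto simp: both_ext_def pal_ext_def intro!: image_eqI[of _ _ "(w, x)"])
    qed (auto simp: both_ext_def pal_ext_def palindrome_def length_factor)
  qed
  from bij_betw_same_card[OF this] show ?thesis
    using finite_factors by (simp add: palindromic_complexity_def)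
qed

text \<open>Each left extension must pair with the only right letter, so the counts cancel. Together
  with the left version, only bispecial factors can have non-zero order.\<close>

lemma bilateral_order_right_unique:
  assumes "card (right_ext u w) = 1" shows "bilateral_order u w = 0"
proof -
  obtain y where y: "right_ext u w = {y}" using assms by (auto simp: card_1_singleton_iff)
  have "both_ext u w = left_ext u w \<times> {y}"
    using both_ext_subset[of w] both_ext_left[of _ w] y by auto
  then show ?thesis using y by (simp add: bilateral_order_def card_cartesian_product)
qed

lemma bilateral_order_left_unique:
  assumes "card (left_ext u w) = 1" shows "bilateral_order u w = 0"
proof -
  obtain y where y: "left_ext u w = {y}" using assms by (auto simp: card_1_singleton_iff)
  have "both_ext u w = {y} \<times> right_ext u w"
    using both_ext_subset[of w] both_ext_right[of _ w] y by auto
  then show ?thesis using y by (simp add: bilateral_order_def card_cartesian_product)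
qed

lemma card_right_ext_pos: "w \<in> factors u n \<Longrightarrow> 1 \<le> card (right_ext u w)"
  using right_ext_nonempty by (metis One_nat_def Suc_leI card_gt_0_iff finite_right_ext)

section \<open>Upper bound from the Rauzy graph\<close>

text \<open>
  The Rauzy graph of order \<open>n\<close>, with every factor identified with its reversal, is connected, and
  palindromic edges become loops. Since \<open>u\<close> is a walk through all vertices, sending each vertex
  class to the edge along which it is first entered is injective off the initial class and avoids
  the loops; this bounds the number of vertex classes.
\<close>
lemma palindromic_complexity_bound:
  "palindromic_complexity u n + palindromic_complexity u (Suc n) + complexity u n
     \<le> complexity u (Suc n) + 2"
proof -
  define cl :: "'a list \<Rightarrow> 'a list set" where "cl = (\<lambda>w. {w, rev w})"
  define v where "v = (\<lambda>i. cl (u [i \<rightarrow> i + n]))"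
  define e where "e = (\<lambda>i. cl (u [i \<rightarrow> Suc (i + n)]))"
  define NP where "NP = {w \<in> factors u (Suc n). \<not> palindrome w}"
  define first where "first = (\<lambda>X. LEAST i. v i = X)"
  have cl_rev: "cl (rev w) = cl w" for w by (auto simp: cl_def)
  have cl_eq: "cl w = cl w' \<Longrightarrow> w = w' \<or> w = rev w'" for w w'
    by (auto simp: cl_def doubleton_eq_iff)
  \<comment> \<open>The ends of an edge are expressed through the edge word alone, so that reversing
    the word can only exchange them.\<close>
  have ends: "{v i, v (Suc i)} = {cl (butlast (u [i \<rightarrow> Suc (i + n)])), cl (tl (u [i \<rightarrow> Suc (i + n)]))}" for i
  proof -
    have "butlast (u [i \<rightarrow> Suc (i + n)]) = (u [i \<rightarrow> i + n])"
      by (simp only: subsequence_Suc_right butlast_snoc)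
    moreover have "tl (u [i \<rightarrow> Suc (i + n)]) = (u [Suc i \<rightarrow> Suc i + n])"
      by (simp only: subsequence_Suc_left list.sel)
    ultimately show ?thesis by (simp only: v_def)
  qed
  have tl_rev: "tl (rev z) = rev (butlast z)" for z :: "'a list"
    by (metis butlast_rev rev_rev_ident)
  have e_ends: "{v i, v (Suc i)} = {v j, v (Suc j)}" if "e i = e j" for i j
  proof -
    from that consider "(u [i \<rightarrow> Suc (i + n)]) = (u [j \<rightarrow> Suc (j + n)])"
      | "(u [i \<rightarrow> Suc (i + n)]) = rev (u [j \<rightarrow> Suc (j + n)])"
      using cl_eq unfolding e_def by blast
    then show ?thesis
      by cases (simp_all only: ends butlast_rev tl_rev cl_rev insert_commute)
  qed
  have range_v: "cl ` factors u n = range v"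
    by (auto simp: factors_eq_range v_def)
  have v_first: "v (first X) = X" if "X \<in> range v" for X
  proof -
    from that obtain i where "v i = X" by auto
    then show ?thesis unfolding first_def by (rule LeastI)
  qed
  have first_le: "first (v i) \<le> i" for i
    unfolding first_def by (rule Least_le) simp
  have step: "first X = Suc (first X - 1)" "v (first X - 1) \<noteq> X" "v (Suc (first X - 1)) = X"
    if "X \<in> range v - {v 0}" for X
  proof -
    have X: "v (first X) = X" "X \<noteq> v 0" using that v_first[of X] by blast+
    have "first X \<noteq> 0"
    proof
      assume "first X = 0"
      then show False using X by simp
    qed
    then show s: "first X = Suc (first X - 1)" by simp
    show "v (Suc (first X - 1)) = X" using X(1) unfolding s[symmetric] .
    show "v (first X - 1) \<noteq> X"
    proof
      assume "v (first X - 1) = X"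
      then have "first X \<le> first X - 1" using first_le[of "first X - 1"] by simp
      then show False using \<open>first X \<noteq> 0\<close> by linarith
    qed
  qed
  \<comment> \<open>The edge traversed just before the first visit to \<open>X\<close>. As
    \<open>X\<close> is not the initial class, \<open>first X\<close> is positive and the
    subtraction is genuine.\<close>
  let ?f = "\<lambda>X. e (first X - 1)"
  have "inj_on ?f (range v - {v 0})"
  proof (rule inj_onI, rule ccontr)
    fix X Y assume X: "X \<in> range v - {v 0}" and Y: "Y \<in> range v - {v 0}"
      and eq: "?f X = ?f Y" and ne: "X \<noteq> Y"
    have "{v (first X - 1), X} = {v (first Y - 1), Y}"
      using e_ends[OF eq] unfolding step(3)[OF X] step(3)[OF Y] .
    \<comment> \<open>Since \<open>X\<close> and \<open>Y\<close> differ, equal end pairs make each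
      the predecessor of the other, so each would be visited before the other.\<close>
    then have "v (first X - 1) = Y" "v (first Y - 1) = X"
      using ne unfolding doubleton_eq_iff by blast+
    then have "first Y \<le> first X - 1" "first X \<le> first Y - 1"
      using first_le[of "first X - 1"] first_le[of "first Y - 1"] by simp_all
    then show False using step(1)[OF X] step(1)[OF Y] by linarith
  qed
  moreover have "?f ` (range v - {v 0}) \<subseteq> cl ` NP"
  proof
    fix c assume "c \<in> ?f ` (range v - {v 0})"
    then obtain X where X: "X \<in> range v - {v 0}" and c: "c = ?f X" by auto
    define i where "i = first X - 1"
    have "v i \<noteq> v (Suc i)" using step(2)[OF X] unfolding i_def step(3)[OF X] .
    have "\<not> palindrome (u [i \<rightarrow> Suc (i + n)])"
    proof
      \<comment> \<open>The ends of a palindromic edge are reversals of each other, hence one class,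
        but this edge joins distinct classes.\<close>
      assume "palindrome (u [i \<rightarrow> Suc (i + n)])"
      then have "tl (u [i \<rightarrow> Suc (i + n)]) = rev (butlast (u [i \<rightarrow> Suc (i + n)]))"
        unfolding palindrome_def by (metis tl_rev)
      then show False using ends[of i] \<open>v i \<noteq> v (Suc i)\<close> cl_rev
        by (metis doubleton_eq_iff)
    qed
    moreover have "(u [i \<rightarrow> Suc (i + n)]) \<in> factors u (Suc n)"
      by (auto simp: factors_eq_range)
    ultimately show "c \<in> cl ` NP" unfolding c i_def[symmetric] e_def NP_def by blast
  qed
  moreover have finNP: "finite NP" unfolding NP_def using finite_factors by simp
  ultimately have "card (range v - {v 0}) \<le> card (cl ` NP)"
    by (meson card_inj_on_le finite_imageI)
  moreover have "card (range v - {v 0}) = card (range v) - 1"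
    by (simp add: card_Diff_singleton)
  \<comment> \<open>The removed initial class becomes \<open>+ 2\<close> after doubling, which
    matches the form of the orbit count.\<close>
  ultimately have le: "2 * card (cl ` factors u n) \<le> 2 * card (cl ` NP) + 2"
    unfolding range_v by linarith
  have V: "2 * card (cl ` factors u n) = complexity u n + palindromic_complexity u n"
    using card_involution_orbits[of "factors u n" rev] finite_factors
    by (simp add: cl_def complexity_def palindromic_complexity_def palindrome_def eq_commute)
  have none: "{x \<in> NP. rev x = x} = {}" by (auto simp: NP_def palindrome_def)
  have "2 * card (cl ` NP) = card NP + card {x \<in> NP. rev x = x}"
    unfolding cl_def
    by (rule card_involution_orbits[OF finNP]) (auto simp: NP_def palindrome_def)
  moreover have "complexity u (Suc n) = card NP + palindromic_complexity u (Suc n)"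
  proof -
    have "factors u (Suc n) = NP \<union> {w \<in> factors u (Suc n). palindrome w}"
      by (auto simp: NP_def)
    then show ?thesis unfolding complexity_def palindromic_complexity_def
      using card_Un_disjoint[of NP "{w \<in> factors u (Suc n). palindrome w}"] finNP finite_factors
      by (auto simp: NP_def)
  qed
  ultimately show ?thesis using le V unfolding none by simp
qed

section \<open>Palindromic extensions and monotonicity\<close>

lemma sym_both_ext_palindrome:
  assumes "palindrome w" and "(x, y) \<in> both_ext u w" shows "(y, x) \<in> both_ext u w"
proof -
  have w: "rev w = w" using assms(1) unfolding palindrome_def by (rule sym)
  have "rev (x # w @ [y]) = y # w @ [x]" by (simp add: w)
  then show ?thesis
    using assms(2) rev_factor_iff[of "x # w @ [y]" "Suc (Suc (length w))"]
    by (simp add: both_ext_def)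
qed

text \<open>Swapping is an involution on the extension pairs of a palindrome, and its fixed points
  are the diagonal pairs counted by \<open>pal_ext\<close>.\<close>

lemma parity_pal_ext:
  assumes "palindrome w" shows "even (card (both_ext u w) + card (pal_ext u w))"
proof -
  have "{p \<in> both_ext u w. prod.swap p = p} = (\<lambda>x. (x, x)) ` pal_ext u w"
  proof (intro equalityI subsetI)
    fix p assume p: "p \<in> {p \<in> both_ext u w. prod.swap p = p}"
    then have "fst (prod.swap p) = fst p" by (metis (mono_tags) mem_Collect_eq)
    then have "p = (fst p, fst p)" by (simp only: fst_swap prod_eq_iff fst_conv snd_conv)
    with p show "p \<in> (\<lambda>x. (x, x)) ` pal_ext u w"
      unfolding pal_ext_def by (metis (mono_tags, lifting) image_eqI mem_Collect_eq)
  qed (auto simp: pal_ext_def)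
  then have "card {p \<in> both_ext u w. prod.swap p = p} = card (pal_ext u w)"
    by (simp add: card_image inj_on_def)
  moreover have "2 * card ((\<lambda>p. {p, prod.swap p}) ` both_ext u w) =
      card (both_ext u w) + card {p \<in> both_ext u w. prod.swap p = p}"
    by (rule card_involution_orbits) (auto intro: sym_both_ext_palindrome[OF assms])
  ultimately have "card (both_ext u w) + card (pal_ext u w) =
      2 * card ((\<lambda>p. {p, prod.swap p}) ` both_ext u w)"
    by (simp only:)
  then show ?thesis by (simp only: dvd_triv_left)
qed

text \<open>Off-diagonal pairs lie in the square of \<open>right_ext u w\<close> without its
  diagonal. For \<open>s\<close> equal to 1 or 2 this bounds the bilateral order by
  \<open>card (pal_ext u w) - 1\<close>, because \<open>s * s - s - 2 * s + 1 = -1\<close>.\<close>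

lemma card_both_ext_le:
  assumes "palindrome w"
  defines "s \<equiv> card (right_ext u w)"
  shows "card (both_ext u w) \<le> card (pal_ext u w) + (s * s - s)"
proof -
  let ?S = "right_ext u w"
  have L: "left_ext u w = ?S" using assms by (simp add: left_ext_eq palindrome_def)
  have "both_ext u w \<subseteq> (\<lambda>x. (x, x)) ` pal_ext u w \<union> (?S \<times> ?S - (\<lambda>x. (x, x)) ` ?S)"
    using both_ext_subset[of w] unfolding L by (auto simp: pal_ext_def)
  then have "card (both_ext u w)
      \<le> card ((\<lambda>x. (x, x)) ` pal_ext u w \<union> (?S \<times> ?S - (\<lambda>x. (x, x)) ` ?S))"
    by (intro card_mono) auto
  also have "\<dots> \<le> card ((\<lambda>x. (x, x)) ` pal_ext u w) + card (?S \<times> ?S - (\<lambda>x. (x, x)) ` ?S)"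
    by (rule card_Un_le)
  also have "card ((\<lambda>x. (x, x)) ` pal_ext u w) = card (pal_ext u w)"
    by (simp add: card_image inj_on_def)
  also have "card (?S \<times> ?S - (\<lambda>x. (x, x)) ` ?S) = s * s - s"
    by (subst card_Diff_subset) (auto simp: s_def card_cartesian_product card_image inj_on_def)
  finally show ?thesis .
qed

text \<open>
  With first difference \<open>2\<close> there are at most two right special factors, so a non-palindromic
  bispecial factor and its reversal leave no palindromic one. Hence the bilateral orders of
  palindromes sum to \<open>0\<close>, and each of them is at most \<open>card (pal_ext u w) - 1\<close>.
\<close>
lemma palindromic_complexity_le_Suc_Suc:
  assumes C1: "complexity u (Suc n) = complexity u n + 2"
    and C2: "complexity u (Suc (Suc n)) = complexity u n + 4"
  shows "palindromic_complexity u n \<le> palindromic_complexity u (Suc (Suc n))"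
proof -
  let ?F = "factors u n"
  let ?P = "{w \<in> ?F. palindrome w}"
  \<comment> \<open>The excess over the one extension that always exists. Excesses are non-negative
    and add up to the first difference 2.\<close>
  let ?d = "\<lambda>w. int (card (right_ext u w)) - 1"
  have fin [simp]: "finite ?F" by (rule finite_factors)
  have sum_d: "sum ?d ?F = 2"
    using C1 by (simp add: sum_subtractf complexity_Suc flip: of_nat_sum) (simp add: complexity_def)
  have d_nonneg: "0 \<le> ?d w" if "w \<in> ?F" for w
    using card_right_ext_pos[OF that] by simp
  have sum_b: "sum (bilateral_order u) ?F = 0"
    using sum_bilateral_order[of n] C1 C2 by simp
  have d_sum_le: "sum ?d W \<le> 2" if "W \<subseteq> ?F" for W
    using sum_mono2[OF fin that, of ?d] d_nonneg sum_d by auto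
  \<comment> \<open>Such a \<open>w\<close> is left and right special, and \<open>w\<close> is left
    special exactly when \<open>rev w\<close> is right special.\<close>
  have b_nonzero: "1 \<le> ?d w \<and> 1 \<le> ?d (rev w)" if "w \<in> ?F" "bilateral_order u w \<noteq> 0" for w
    using bilateral_order_right_unique[of w] bilateral_order_left_unique[of w] that
      card_right_ext_pos[of w n] card_right_ext_pos[of "rev w" n]
    by (auto simp: left_ext_eq le_less)
  have sum_pal: "sum (bilateral_order u) ?P = 0"
  proof (cases "\<exists>w \<in> ?F - ?P. bilateral_order u w \<noteq> 0")
    case True
    then obtain w where w: "w \<in> ?F" "w \<noteq> rev w" "bilateral_order u w \<noteq> 0"
      by (auto simp: palindrome_def)
    have "bilateral_order u p = 0" if p: "p \<in> ?P" for p
    proof (rule ccontr)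
      assume "bilateral_order u p \<noteq> 0"
      then have "1 \<le> ?d p" using b_nonzero p by blast
      moreover have "p \<noteq> w" "p \<noteq> rev w" using p w(2) by (auto simp: palindrome_def)
      ultimately have "3 \<le> sum ?d {p, w, rev w}"
        using b_nonzero[OF w(1,3)] w(2) by simp
      then show False using d_sum_le[of "{p, w, rev w}"] p w(1) by simp
    qed
    then show ?thesis by simp
  next
    case False
    have "sum (bilateral_order u) ?P = sum (bilateral_order u) ?F"
      by (rule sum.mono_neutral_left) (use False in auto)
    then show ?thesis using sum_b by simp
  qed
  have "bilateral_order u w \<le> int (card (pal_ext u w)) - 1" if "w \<in> ?P" for w
  proof -
    have w: "w \<in> ?F" "palindrome w" using that by auto
    have L: "left_ext u w = right_ext u w" using w by (simp add: left_ext_eq palindrome_def)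
    have "?d w \<le> 2" using d_sum_le[of "{w}"] w by simp
    then consider "card (right_ext u w) = 1" | "card (right_ext u w) = 2" | "card (right_ext u w) = 3"
      using card_right_ext_pos[OF w(1)] by linarith
    then show ?thesis
    proof cases
      \<comment> \<open>Here \<open>card_both_ext_le\<close> is too weak. Instead, \<open>w\<close>
        uses up the whole excess 2, so all other orders vanish and therefore its own. This leaves
        \<open>0 + 3 + 3 - 1 = 5\<close> pairs, and parity forces a palindromic extension.\<close>
      case 3
      have "bilateral_order u v = 0" if "v \<in> ?F - {w}" for v
      proof (rule ccontr)
        assume "bilateral_order u v \<noteq> 0"
        then have "3 \<le> sum ?d {v, w}" using b_nonzero[of v] that 3 by simp
        then show False using d_sum_le[of "{v, w}"] that w by simp
      qed
      then have "bilateral_order u w = 0"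
        using sum_b sum.remove[OF fin w(1), of "bilateral_order u"] by simp
      moreover from this have "card (both_ext u w) = 5"
        using 3 by (simp add: bilateral_order_def L)
      with parity_pal_ext[OF w(2)] have "card (pal_ext u w) \<noteq> 0" by auto
      ultimately show ?thesis by (simp add: card_gt_0_iff)
    qed (use card_both_ext_le[OF w(2)] in \<open>simp_all add: bilateral_order_def L\<close>)
  qed
  \<comment> \<open>The sum equals the number of palindromes of length \<open>n + 2\<close> minus
    the number of length \<open>n\<close>.\<close>
  then have "0 \<le> (\<Sum>w\<in>?P. int (card (pal_ext u w)) - 1)"
    using sum_mono[of ?P "bilateral_order u" "\<lambda>w. int (card (pal_ext u w)) - 1"] sum_pal by simp
  then show ?thesis
    by (simp add: sum_subtractf palindromic_complexity_Suc_Suc flip: of_nat_sum)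
       (simp add: palindromic_complexity_def)
qed

end

section \<open>Combination of the two bounds\<close>

theorem theorem1:
  fixes A :: "'a set" and u :: "'a word"
  assumes "card A = 3"
    and "range u \<subseteq> A"
    and "closed_under_reversal (language u)"
    and "\<And>n. complexity u n = 2 * n + 1"
  shows "property_P A u"
proof -
  \<comment> \<open>An infinite set has \<open>card\<close> 0, so the positive value
    \<open>2 * n + 1\<close> yields finiteness.\<close>
  have "finite (factors u n)" for n
    using assms(4)[of n] by (intro card_ge_0_finite) (simp add: complexity_def)
  then interpret reversal_closed_word u
    using assms(3) by unfold_locales
  \<comment> \<open>Words of length at most 1 are palindromes, which gives \<open>1 + 3 = 4\<close>
    in the base case.\<close>
  have short: "palindromic_complexity u n = complexity u n" if "n \<le> 1" for n
  proof -
    have "palindrome w" if "w \<in> factors u n" for w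
      using \<open>n \<le> 1\<close> length_factor[OF that] by (cases w) (auto simp: palindrome_def)
    then have "{w \<in> factors u n. palindrome w} = factors u n" by auto
    then show ?thesis by (simp add: palindromic_complexity_def complexity_def)
  qed
  have "palindromic_complexity u n + palindromic_complexity u (Suc n) = 4" for n
  proof (induction n)
    case 0
    show ?case using short[of 0] short[of 1] assms(4) by simp
  next
    case (Suc n)
    \<comment> \<open>With the induction hypothesis this gives at least 4; the Rauzy graph bound
      below gives at most \<open>2 + 2\<close>.\<close>
    moreover have "palindromic_complexity u n \<le> palindromic_complexity u (Suc (Suc n))"
      by (rule palindromic_complexity_le_Suc_Suc) (simp_all add: assms(4))
    moreover have "palindromic_complexity u (Suc n) + palindromic_complexity u (Suc (Suc n)) \<le> 4"
      using palindromic_complexity_bound[of "Suc n"] assms(4) by simp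
    ultimately show ?case by linarith
  qed
  then show ?thesis by (simp add: property_P_def assms(1))
qed

end
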